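(* Let $G$ be a finite simple graph that has a pendant vertex (a vertex of degree $1$). Then $d_{\rm st}(G)=1$ or $d_{\rm st}(G)=2$.
   Context: For a finite simple graph $G=(V,E)$, a set $D\subseteq V$ is a strong dominating set if for every vertex $x\in V\setminus D$ there is a vertex $y\in D$ with $xy\in E$ and $\deg(x)\le \deg(y)$. A strong domatic partition of $G$ is a partition of $V(G)$ all of whose classes are strong dominating sets of $G$. The strong domatic number $d_{\rm st}(G)$ is the maximum number of classes of a strong domatic partition of $G$. *)

theory Defs
  imports "HOL-Library.Disjoint_Sets" "Graph_Theory.Pair_Digraph"
begin

(* A finite simple graph is a pair_graph: a finite, loop-free, symmetric digraph without
   parallel arcs, in which each edge xy is represented by the two arcs (x, y) and (y, x).
   Each edge at v thus contributes exactly one arc leaving v, so the degree of v is its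
   out-degree. *)
abbreviation deg :: "'a pair_pre_digraph \<Rightarrow> 'a \<Rightarrow> nat" where
  "deg G v \<equiv> out_degree (with_proj G) v"

definition strong_dominating_set :: "'a pair_pre_digraph \<Rightarrow> 'a set \<Rightarrow> bool" where
  "strong_dominating_set G D \<longleftrightarrow>
     D \<subseteq> pverts G \<and>
     (\<forall>x \<in> pverts G - D. \<exists>y \<in> D. (x, y) \<in> parcs G \<and> deg G x \<le> deg G y)"

definition strong_domatic_partition :: "'a pair_pre_digraph \<Rightarrow> 'a set set \<Rightarrow> bool" where
  "strong_domatic_partition G P \<longleftrightarrow>
     partition_on (pverts G) P \<and> (\<forall>D \<in> P. strong_dominating_set G D)"

(* For a finite graph the maximum ranges over a finite set, nonempty because the partition
   of the vertex set into at most one class is always strong domatic. *)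
definition strong_domatic_number :: "'a pair_pre_digraph \<Rightarrow> nat" where
  "strong_domatic_number G = Max {card P | P. strong_domatic_partition G P}"

end

theory Submission
  imports Defs
begin

text \<open>Fix a vertex \<open>v\<close>. A class of a strong domatic partition either contains
  \<open>v\<close> or must dominate \<open>v\<close> through a neighbour, so every class meets the
  closed neighbourhood of \<open>v\<close>. Since the classes are disjoint, there are at most
  \<open>deg G v + 1\<close> of them (\<open>card_strong_domatic_partition_le\<close>). For a
  pendant vertex this bound is 2, and the one-class partition
  (\<open>strong_domatic_partition_trivial\<close>) gives the lower bound 1.\<close>

lemma card_strong_domatic_partition_le:
  assumes "pair_graph G" and "v \<in> pverts G" and P: "strong_domatic_partition G P"
  shows "card P \<le> deg G v + 1"
proof -
  interpret pair_graph G by fact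
  let ?A = "out_arcs (with_proj G) v"
  \<comment> \<open>The closed neighbourhood of \<open>v\<close>: the heads of the arcs leaving
    \<open>v\<close>, and \<open>v\<close> itself, which accounts for the \<open>+ 1\<close> in the
    bound.\<close>
  let ?N = "insert v (snd ` ?A)"
  have fin: "finite ?A"
    by (rule finite_subset[OF _ finite_arcs]) (auto simp: out_arcs_def)
  have part: "partition_on (pverts G) P"
    and dom: "\<And>D. D \<in> P \<Longrightarrow> strong_dominating_set G D"
    using P by (auto simp: strong_domatic_partition_def)
  have meets: "\<exists>y. y \<in> D \<inter> ?N" if "D \<in> P" for D
  proof (cases "v \<in> D")
    case False
    then obtain y where "y \<in> D" "(v, y) \<in> parcs G"
      using dom[OF \<open>D \<in> P\<close>] \<open>v \<in> pverts G\<close> by (auto simp: strong_dominating_set_def)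
    then have "(v, y) \<in> ?A"
      by (simp add: out_arcs_def)
    then have "y \<in> ?N"
      by (metis image_eqI insertI2 snd_conv)
    with \<open>y \<in> D\<close> show ?thesis
      by blast
  qed auto
  \<comment> \<open>Each class gets a representative in \<open>?N\<close>; a vertex shared by two
    classes would contradict disjointness, so the choice is injective.\<close>
  define f where "f D = (SOME y. y \<in> D \<inter> ?N)" for D
  have f: "f D \<in> D \<inter> ?N" if "D \<in> P" for D
    unfolding f_def by (rule someI_ex) (rule meets[OF that])
  have "inj_on f P"
  proof (rule inj_onI)
    fix D E
    assume "D \<in> P" "E \<in> P" "f D = f E"
    then have "f D \<in> D \<inter> E"
      using f[of D] f[of E] by simp
    then show "D = E"
      using disjointD[OF partition_onD2[OF part] \<open>D \<in> P\<close> \<open>E \<in> P\<close>] by blast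
  qed
  then have "card P \<le> card ?N"
    by (rule card_inj_on_le) (use f fin in \<open>blast, simp\<close>)
  also have "\<dots> \<le> card (snd ` ?A) + 1"
    using fin by (simp add: card_insert_if)
  also have "\<dots> \<le> deg G v + 1"
    using fin by (simp add: out_degree_def card_image_le)
  finally show ?thesis .
qed

text \<open>No vertex lies outside the single class, so domination is vacuous; the assumption is
  there because partition classes must be nonempty.\<close>

lemma strong_domatic_partition_trivial:
  assumes "pverts G \<noteq> {}"
  shows "strong_domatic_partition G {pverts G}"
  using assms by (auto simp: strong_domatic_partition_def strong_dominating_set_def
      partition_on_def disjoint_def)

theorem theorem2p1:
  fixes G :: "'a pair_pre_digraph"
  assumes "pair_graph G"
    and "\<exists>v \<in> pverts G. deg G v = 1"
  shows "strong_domatic_number G = 1 \<or> strong_domatic_number G = 2"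
proof -
  obtain v where v: "v \<in> pverts G" "deg G v = 1"
    using assms(2) by blast
  let ?S = "{card P | P. strong_domatic_partition G P}"
  have le: "n \<le> 2" if "n \<in> ?S" for n
    using that card_strong_domatic_partition_le[OF assms(1) v(1)] v(2) by force
  \<comment> \<open>\<open>Max\<close> is a true maximum only on a finite nonempty set: the uniform
    bound 2 gives finiteness, and \<open>one\<close> below gives nonemptiness.\<close>
  then have fin: "finite ?S"
    by (meson finite_nat_set_iff_bounded_le)
  have "card {pverts G} \<in> ?S"
    using strong_domatic_partition_trivial[of G] v(1) by blast
  then have one: "1 \<in> ?S"
    by simp
  have "1 \<le> Max ?S"
    using fin one by (rule Max_ge)
  moreover have "Max ?S \<le> 2"
    using le Max_in[OF fin] one by blast
  ultimately show ?thesis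
    unfolding strong_domatic_number_def by linarith
qed

end
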